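(* Let $(M,d)$ be a complete metric space, let $\mu\in M$ and let $\{\mu_n\}_{n\ge 1}\subset M$ with $d(\mu_n,\mu)\to 0$. Let $K_\mu$ and $K_{\mu_n}$ ($n\ge1$) be closed convex subsets of $\mathbb{R}^q$ containing $0$. If $K_{\mu_n}\overset{M}{\rightarrow}K_{\mu}$ (Mosco convergence in $\mathbb{R}^q$), then for every $u\in H[0,T]$, the projections $P_{U_{\mu_n}[0,T]}(u)$ converge strongly in $H[0,T]$ to $P_{U_{\mu}[0,T]}(u)$.
   Context: $(\Omega,\mathcal{F},\{\mathcal{F}_t\}_{t\ge0},\mathbb{P})$ is a complete filtered probability space and $T>0$. $H[0,T]=\mathcal{L}^2_{ad}([0,T]\times\Omega,\mathbb{R}^q)$ is the Hilbert space of $\mathbb{R}^q$-valued $\mathcal{F}_t$-adapted stochastic processes $f$ with $\int_0^T\mathbb{E}\|f(t,\omega)\|^2dt<\infty$, with inner product $\langle u,v\rangle_{H[0,T]}=\int_0^T\mathbb{E}\langle u(t,\omega),v(t,\omega)\rangle dt$. For $\nu\in\{\mu,\mu_1,\mu_2,\dots\}$, $U_{\nu}[0,T]=\{u\in H[0,T]: u(t,\omega)\in K_\nu \text{ for a.e. } t\in[0,T],\ \text{a.s. }\omega\in\Omega\}$. $P_S$ denotes the metric projection onto a nonempty closed convex set $S$ of a Hilbert space. Mosco convergence: for closed convex subsets $C_n$ ($n\ge1$) and $C_0$ of a Hilbert space, $C_n\overset{M}{\rightarrow}C_0$ means $w\text{-}Ls_n C_n\subset C_0\subset s\text{-}Li_n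 C_n$, where $x\in s\text{-}Li_n C_n$ iff there are $x_n\in C_n$ with $x_n\to x$ strongly, and $x\in w\text{-}Ls_n C_n$ iff there are a subsequence $\{C_{n_i}\}$ of $\{C_n\}$ and $x_{n_i}\in C_{n_i}$ with $x_{n_i}\rightharpoonup x$ weakly. *)

theory Defs
  imports "HOL-Probability.Probability"
begin

section \<open>Mosco convergence in a real Hilbert space\<close>

text \<open>Sequences are indexed by \<^typ>\<open>nat\<close>, so index \<open>n\<close> plays the role of \<open>n + 1\<close> in an
  enumeration starting at 1.\<close>

definition weakly_converges_to :: "(nat \<Rightarrow> 'a::{real_inner,complete_space}) \<Rightarrow> 'a \<Rightarrow> bool" where
  "weakly_converges_to xs x \<longleftrightarrow> (\<forall>y. (\<lambda>n. inner (xs n) y) \<longlonglongrightarrow> inner x y)"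

definition strong_Li :: "(nat \<Rightarrow> 'a::{real_inner,complete_space} set) \<Rightarrow> 'a set" where
  "strong_Li C = {x. \<exists>xs. (\<forall>n. xs n \<in> C n) \<and> xs \<longlonglongrightarrow> x}"

definition weak_Ls :: "(nat \<Rightarrow> 'a::{real_inner,complete_space} set) \<Rightarrow> 'a set" where
  "weak_Ls C = {x. \<exists>r xs. strict_mono r \<and> (\<forall>i. xs i \<in> C (r i)) \<and> weakly_converges_to xs x}"

definition mosco_converges :: "(nat \<Rightarrow> 'a::{real_inner,complete_space} set) \<Rightarrow> 'a set \<Rightarrow> bool" where
  "mosco_converges C C0 \<longleftrightarrow> weak_Ls C \<subseteq> C0 \<and> C0 \<subseteq> strong_Li C"


section \<open>Complete filtered probability spaces\<close>

text \<open>Only the values \<open>F t\<close> with \<open>t \<ge> 0\<close> are constrained. Completeness means that \<open>P\<close> is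
  complete and that every \<open>P\<close>-null set belongs to \<open>F 0\<close>, hence to every \<open>F t\<close>; right continuity
  of the filtration is not assumed.\<close>

locale complete_filtered_prob_space = prob_space P + complete_measure P
  for P :: "'w measure" and F :: "real \<Rightarrow> 'w measure" +
  assumes subalg: "\<And>t. 0 \<le> t \<Longrightarrow> subalgebra P (F t)"
    and filtration_mono: "\<And>s t. 0 \<le> s \<Longrightarrow> s \<le> t \<Longrightarrow> sets (F s) \<subseteq> sets (F t)"
    and null_sets_F0: "null_sets P \<subseteq> sets (F 0)"


section \<open>The Hilbert space of square integrable adapted processes\<close>

abbreviation time_measure :: "real \<Rightarrow> real measure" where
  "time_measure T \<equiv> restrict_space lborel {0..T}"

text \<open>Processes are jointly measurable on \<open>[0,T] \<times> \<Omega>\<close>; their values outside of this set are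
  irrelevant and are identified by \<open>process_eq\<close> below.\<close>

definition L2_ad :: "'w measure \<Rightarrow> (real \<Rightarrow> 'w measure) \<Rightarrow> real \<Rightarrow> (real \<Rightarrow> 'w \<Rightarrow> real^'q) set" where
  "L2_ad P F T = {f.
      (\<lambda>(t, w). f t w) \<in> borel_measurable (time_measure T \<Otimes>\<^sub>M P) \<and>
      (\<forall>t\<in>{0..T}. f t \<in> borel_measurable (F t)) \<and>
      (\<integral>\<^sup>+ t. (\<integral>\<^sup>+ w. ennreal ((norm (f t w))\<^sup>2) \<partial>P) \<partial>time_measure T) < \<infinity>}"

definition process_eq ::
  "'w measure \<Rightarrow> (real \<Rightarrow> 'w measure) \<Rightarrow> real \<Rightarrow> ((real \<Rightarrow> 'w \<Rightarrow> real^'q) \<times> (real \<Rightarrow> 'w \<Rightarrow> real^'q)) set" where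
  "process_eq P F T = {(f, g). f \<in> L2_ad P F T \<and> g \<in> L2_ad P F T \<and>
      (AE t in time_measure T. AE w in P. f t w = g t w)}"

definition H_space :: "'w measure \<Rightarrow> (real \<Rightarrow> 'w measure) \<Rightarrow> real \<Rightarrow> (real \<Rightarrow> 'w \<Rightarrow> real^'q) set set" where
  "H_space P F T = L2_ad P F T // process_eq P F T"

definition H_class ::
  "'w measure \<Rightarrow> (real \<Rightarrow> 'w measure) \<Rightarrow> real \<Rightarrow> (real \<Rightarrow> 'w \<Rightarrow> real^'q) \<Rightarrow> (real \<Rightarrow> 'w \<Rightarrow> real^'q) set" where
  "H_class P F T f = process_eq P F T `` {f}"

definition H_rep :: "(real \<Rightarrow> 'w \<Rightarrow> real^'q) set \<Rightarrow> real \<Rightarrow> 'w \<Rightarrow> real^'q" where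
  "H_rep X = (SOME f. f \<in> X)"

text \<open>The choice of representatives is immaterial, see \<open>H_inner_class\<close>, \<open>H_minus_class\<close>
  and \<open>U_set_class\<close>.\<close>

definition H_inner :: "'w measure \<Rightarrow> real \<Rightarrow> (real \<Rightarrow> 'w \<Rightarrow> real^'q) set \<Rightarrow> (real \<Rightarrow> 'w \<Rightarrow> real^'q) set \<Rightarrow> real" where
  "H_inner P T X Y = (\<integral>t. (\<integral>w. inner (H_rep X t w) (H_rep Y t w) \<partial>P) \<partial>time_measure T)"

definition H_minus ::
  "'w measure \<Rightarrow> (real \<Rightarrow> 'w measure) \<Rightarrow> real \<Rightarrow> (real \<Rightarrow> 'w \<Rightarrow> real^'q) set
    \<Rightarrow> (real \<Rightarrow> 'w \<Rightarrow> real^'q) set \<Rightarrow> (real \<Rightarrow> 'w \<Rightarrow> real^'q) set" where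
  "H_minus P F T X Y = H_class P F T (\<lambda>t w. H_rep X t w - H_rep Y t w)"

definition H_norm :: "'w measure \<Rightarrow> real \<Rightarrow> (real \<Rightarrow> 'w \<Rightarrow> real^'q) set \<Rightarrow> real" where
  "H_norm P T X = sqrt (H_inner P T X X)"

definition H_dist ::
  "'w measure \<Rightarrow> (real \<Rightarrow> 'w measure) \<Rightarrow> real \<Rightarrow> (real \<Rightarrow> 'w \<Rightarrow> real^'q) set
    \<Rightarrow> (real \<Rightarrow> 'w \<Rightarrow> real^'q) set \<Rightarrow> real" where
  "H_dist P F T X Y = H_norm P T (H_minus P F T X Y)"

definition U_set ::
  "'w measure \<Rightarrow> (real \<Rightarrow> 'w measure) \<Rightarrow> real \<Rightarrow> (real^'q) set \<Rightarrow> (real \<Rightarrow> 'w \<Rightarrow> real^'q) set set" where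
  "U_set P F T K = {X \<in> H_space P F T. AE t in time_measure T. AE w in P. H_rep X t w \<in> K}"

definition metric_projection :: "('h \<Rightarrow> 'h \<Rightarrow> real) \<Rightarrow> 'h set \<Rightarrow> 'h \<Rightarrow> 'h" where
  "metric_projection d S x = (THE p. p \<in> S \<and> (\<forall>y\<in>S. d x p \<le> d x y))"

abbreviation H_proj ::
  "'w measure \<Rightarrow> (real \<Rightarrow> 'w measure) \<Rightarrow> real \<Rightarrow> (real \<Rightarrow> 'w \<Rightarrow> real^'q) set set
    \<Rightarrow> (real \<Rightarrow> 'w \<Rightarrow> real^'q) set \<Rightarrow> (real \<Rightarrow> 'w \<Rightarrow> real^'q) set" where
  "H_proj P F T S X \<equiv> metric_projection (H_dist P F T) S X"


subsection \<open>Independence of the representatives\<close>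

lemma equiv_process_eq: "equiv (L2_ad P F T) (process_eq P F T)"
proof (rule equivI)
  show "process_eq P F T \<subseteq> L2_ad P F T \<times> L2_ad P F T"
    by (auto simp: process_eq_def)
  show "refl_on (L2_ad P F T) (process_eq P F T)"
    by (auto simp: refl_on_def process_eq_def)
  show "sym (process_eq P F T)"
    by (auto simp: sym_def process_eq_def eq_commute)
  show "trans (process_eq P F T)"
  proof (rule transI)
    fix f g h assume fg: "(f, g) \<in> process_eq P F T" and gh: "(g, h) \<in> process_eq P F T"
    have 1: "AE t in time_measure T. AE w in P. f t w = g t w"
      and 2: "AE t in time_measure T. AE w in P. g t w = h t w"
      using fg gh by (auto simp: process_eq_def)
    from 1 2 have "AE t in time_measure T. AE w in P. f t w = h t w"
    proof eventually_elim
      case (elim t)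
      then show ?case by eventually_elim simp
    qed
    with fg gh show "(f, h) \<in> process_eq P F T" by (auto simp: process_eq_def)
  qed
qed

lemma H_rep_class:
  assumes "f \<in> L2_ad P F T"
  shows "(f, H_rep (H_class P F T f)) \<in> process_eq P F T"
proof -
  have "f \<in> H_class P F T f"
    unfolding H_class_def using assms equiv_process_eq equiv_class_self by metis
  then have "H_rep (H_class P F T f) \<in> H_class P F T f"
    unfolding H_rep_def by (rule someI[where P = "\<lambda>h. h \<in> H_class P F T f"])
  then show ?thesis by (simp add: H_class_def)
qed

context complete_filtered_prob_space
begin

lemma H_inner_class:
  fixes f g :: "real \<Rightarrow> 'w \<Rightarrow> real^'q"
  assumes "f \<in> L2_ad P F T" "g \<in> L2_ad P F T"
  shows "H_inner P T (H_class P F T f) (H_class P F T g)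
    = (\<integral>t. (\<integral>w. inner (f t w) (g t w) \<partial>P) \<partial>time_measure T)"
proof -
  define f' where "f' = H_rep (H_class P F T f)"
  define g' where "g' = H_rep (H_class P F T g)"
  have ff: "(f, f') \<in> process_eq P F T" and gg: "(g, g') \<in> process_eq P F T"
    using assms H_rep_class unfolding f'_def g'_def by blast+
  have meas [measurable]:
    "(\<lambda>(t, w). f t w) \<in> borel_measurable (time_measure T \<Otimes>\<^sub>M P)"
    "(\<lambda>(t, w). g t w) \<in> borel_measurable (time_measure T \<Otimes>\<^sub>M P)"
    "(\<lambda>(t, w). f' t w) \<in> borel_measurable (time_measure T \<Otimes>\<^sub>M P)"
    "(\<lambda>(t, w). g' t w) \<in> borel_measurable (time_measure T \<Otimes>\<^sub>M P)"
    using ff gg by (auto simp: process_eq_def L2_ad_def)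
  have AEf: "AE t in time_measure T. AE w in P. f t w = f' t w"
    and AEg: "AE t in time_measure T. AE w in P. g t w = g' t w"
    using ff gg by (auto simp: process_eq_def)
  have "(\<integral>t. (\<integral>w. inner (f' t w) (g' t w) \<partial>P) \<partial>time_measure T)
    = (\<integral>t. (\<integral>w. inner (f t w) (g t w) \<partial>P) \<partial>time_measure T)"
  proof (rule integral_cong_AE)
    show "(\<lambda>t. \<integral>w. inner (f' t w) (g' t w) \<partial>P) \<in> borel_measurable (time_measure T)"
      "(\<lambda>t. \<integral>w. inner (f t w) (g t w) \<partial>P) \<in> borel_measurable (time_measure T)"
      by (measurable; simp)+
    from AEf AEg AE_space
    show "AE t in time_measure T. (\<integral>w. inner (f' t w) (g' t w) \<partial>P) = (\<integral>w. inner (f t w) (g t w) \<partial>P)"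
    proof eventually_elim
      case (elim t)
      note [measurable] = measurable_Pair2[OF meas(1) elim(3), simplified]
        measurable_Pair2[OF meas(2) elim(3), simplified]
        measurable_Pair2[OF meas(3) elim(3), simplified]
        measurable_Pair2[OF meas(4) elim(3), simplified]
      show ?case
      proof (rule integral_cong_AE)
        show "AE w in P. inner (f' t w) (g' t w) = inner (f t w) (g t w)"
          using elim(1,2) by eventually_elim simp
      qed measurable
    qed
  qed
  then show ?thesis by (simp add: H_inner_def f'_def g'_def)
qed

lemma L2_ad_diff:
  fixes f g :: "real \<Rightarrow> 'w \<Rightarrow> real^'q"
  assumes f: "f \<in> L2_ad P F T" and g: "g \<in> L2_ad P F T"
  shows "(\<lambda>t w. f t w - g t w) \<in> L2_ad P F T"
proof -
  have meas [measurable]: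
    "(\<lambda>(t, w). f t w) \<in> borel_measurable (time_measure T \<Otimes>\<^sub>M P)"
    "(\<lambda>(t, w). g t w) \<in> borel_measurable (time_measure T \<Otimes>\<^sub>M P)"
    using f g by (auto simp: L2_ad_def)
  let ?N = "\<lambda>h::real \<Rightarrow> 'w \<Rightarrow> real^'q. (\<integral>\<^sup>+ t. (\<integral>\<^sup>+ w. ennreal ((norm (h t w))\<^sup>2) \<partial>P) \<partial>time_measure T)"
  have le: "ennreal ((norm (x - y))\<^sup>2) \<le> 2 * ennreal ((norm x)\<^sup>2) + 2 * ennreal ((norm y)\<^sup>2)"
    for x y :: "real^'q"
  proof -
    have "(norm (x - y))\<^sup>2 \<le> (norm x + norm y)\<^sup>2"
      by (intro power_mono norm_triangle_ineq4) auto
    also have "\<dots> \<le> 2 * (norm x)\<^sup>2 + 2 * (norm y)\<^sup>2"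
      using sum_squares_bound[of "norm x" "norm y"] by (simp add: power2_sum)
    finally have "ennreal ((norm (x - y))\<^sup>2) \<le> ennreal (2 * (norm x)\<^sup>2 + 2 * (norm y)\<^sup>2)"
      by (rule ennreal_leI)
    then show ?thesis by (simp add: ennreal_plus ennreal_mult)
  qed
  have meas2 [measurable]: "(\<lambda>w. f t w) \<in> borel_measurable P" "(\<lambda>w. g t w) \<in> borel_measurable P"
    if "t \<in> space (time_measure T)" for t
    using measurable_Pair2[OF meas(1) that] measurable_Pair2[OF meas(2) that] by simp_all
  have "?N (\<lambda>t w. f t w - g t w)
    \<le> (\<integral>\<^sup>+ t. (\<integral>\<^sup>+ w. 2 * ennreal ((norm (f t w))\<^sup>2) + 2 * ennreal ((norm (g t w))\<^sup>2) \<partial>P) \<partial>time_measure T)"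
    by (intro nn_integral_mono le)
  also have "\<dots> = (\<integral>\<^sup>+ t. 2 * (\<integral>\<^sup>+ w. ennreal ((norm (f t w))\<^sup>2) \<partial>P)
      + 2 * (\<integral>\<^sup>+ w. ennreal ((norm (g t w))\<^sup>2) \<partial>P) \<partial>time_measure T)"
    by (intro nn_integral_cong) (simp add: nn_integral_add nn_integral_cmult meas2)
  also have "\<dots> = 2 * ?N f + 2 * ?N g"
    by (subst nn_integral_add) (auto simp: nn_integral_cmult)
  also have "\<dots> < \<infinity>"
    using f g by (auto simp: L2_ad_def ennreal_mult_less_top)
  finally have fin: "?N (\<lambda>t w. f t w - g t w) < \<infinity>" .
  have "\<forall>t\<in>{0..T}. (\<lambda>w. f t w - g t w) \<in> borel_measurable (F t)"
    using f g unfolding L2_ad_def by (blast intro: borel_measurable_diff)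
  moreover have "(\<lambda>(t, w). f t w - g t w) \<in> borel_measurable (time_measure T \<Otimes>\<^sub>M P)"
    by measurable
  ultimately show ?thesis
    using fin unfolding L2_ad_def by blast
qed

lemma H_minus_class:
  fixes f g :: "real \<Rightarrow> 'w \<Rightarrow> real^'q"
  assumes "f \<in> L2_ad P F T" "g \<in> L2_ad P F T"
  shows "H_minus P F T (H_class P F T f) (H_class P F T g) = H_class P F T (\<lambda>t w. f t w - g t w)"
proof -
  define f' where "f' = H_rep (H_class P F T f)"
  define g' where "g' = H_rep (H_class P F T g)"
  have ff: "(f, f') \<in> process_eq P F T" and gg: "(g, g') \<in> process_eq P F T"
    using assms H_rep_class unfolding f'_def g'_def by blast+
  have AEf: "AE t in time_measure T. AE w in P. f t w = f' t w"
    and AEg: "AE t in time_measure T. AE w in P. g t w = g' t w"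
    using ff gg by (auto simp: process_eq_def)
  from AEf AEg have "AE t in time_measure T. AE w in P. f t w - g t w = f' t w - g' t w"
  proof eventually_elim
    case (elim t)
    then show ?case by eventually_elim simp
  qed
  then have "((\<lambda>t w. f t w - g t w), (\<lambda>t w. f' t w - g' t w)) \<in> process_eq P F T"
    using ff gg L2_ad_diff[of f T g] L2_ad_diff[of f' T g'] by (simp add: process_eq_def)
  from equiv_class_eq[OF equiv_process_eq this]
  have "H_class P F T (\<lambda>t w. f' t w - g' t w) = H_class P F T (\<lambda>t w. f t w - g t w)"
    by (simp add: H_class_def)
  then show ?thesis by (simp add: H_minus_def f'_def g'_def)
qed

lemma U_set_class:
  fixes f :: "real \<Rightarrow> 'w \<Rightarrow> real^'q"
  assumes "f \<in> L2_ad P F T"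
  shows "H_class P F T f \<in> U_set P F T K \<longleftrightarrow> (AE t in time_measure T. AE w in P. f t w \<in> K)"
proof -
  define f' where "f' = H_rep (H_class P F T f)"
  have "AE t in time_measure T. AE w in P. f t w = f' t w"
    using H_rep_class[OF assms] unfolding f'_def by (auto simp: process_eq_def)
  then have "AE t in time_measure T. (AE w in P. f t w \<in> K) \<longleftrightarrow> (AE w in P. f' t w \<in> K)"
  proof eventually_elim
    case (elim t)
    then have "AE w in P. f t w \<in> K \<longleftrightarrow> f' t w \<in> K" by eventually_elim simp
    then show ?case by (rule eventually_subst)
  qed
  then have "(AE t in time_measure T. AE w in P. f t w \<in> K)
    \<longleftrightarrow> (AE t in time_measure T. AE w in P. f' t w \<in> K)"
    by (rule eventually_subst)
  moreover have "H_class P F T f \<in> H_space P F T"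
    using assms by (simp add: H_class_def H_space_def quotientI)
  ultimately show ?thesis by (simp add: U_set_def f'_def)
qed

end

end

theory Submission
  imports Defs
begin

text \<open>The projection onto \<open>U_set P F T C\<close> acts pointwise: it sends a process \<open>f\<close> to
  \<open>\<lambda>t w. closest_point C (f t w)\<close>, which is again adapted since \<open>closest_point C\<close> is continuous, and
  square integrable since \<open>0 \<in> C\<close> makes \<open>closest_point C\<close> norm-decreasing. In \<open>\<real>\<^sup>q\<close>, Mosco
  convergence implies pointwise convergence of the projections by compactness of balls; the domination
  \<open>norm (closest_point C x) \<le> norm x\<close> then gives convergence in \<open>H[0,T]\<close>.\<close>

section \<open>Closest points in Euclidean space and Mosco convergence\<close>

lemma norm_closest_point_le:
  fixes C :: "'a::euclidean_space set"
  assumes "closed C" "convex C" "0 \<in> C"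
  shows "norm (closest_point C x) \<le> norm x"
  using closest_point_lipschitz[of C x 0] closest_point_self[of 0 C] assms by auto

text \<open>The variational inequality at the closest point makes the cross term nonnegative when
  \<open>x - y\<close> is split there. The second square is kept because, once integrated, it yields
  uniqueness of the projection in H[0,T] and not only minimality.\<close>

lemma closest_point_pythagoras:
  fixes C :: "'a::euclidean_space set"
  assumes "closed C" "convex C" "y \<in> C"
  shows "(norm (x - closest_point C x))\<^sup>2 + (norm (y - closest_point C x))\<^sup>2 \<le> (norm (x - y))\<^sup>2"
proof -
  have "inner (x - closest_point C x) (y - closest_point C x) \<le> 0"
    using closest_point_dot assms by blast
  then show ?thesis
    by (simp add: power2_norm_eq_inner inner_diff_left inner_diff_right inner_commute)
qed

lemma tendsto_imp_weakly_converges_to: "xs \<longlonglongrightarrow> x \<Longrightarrow> weakly_converges_to xs x"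
  by (auto simp: weakly_converges_to_def intro!: tendsto_intros)

text \<open>The \<open>weak_Ls\<close> half of Mosco convergence places cluster points of the
  projections in \<open>D\<close>; the \<open>strong_Li\<close> half makes them minimise the
  distance to \<open>x\<close> over \<open>D\<close>. Uniqueness of the closest point then leaves
  only one possible cluster point.\<close>

lemma mosco_converges_imp_closest_point_tendsto:
  fixes C :: "nat \<Rightarrow> 'a::euclidean_space set"
  assumes mosco: "mosco_converges C D"
    and D: "closed D" "convex D"
    and C: "\<And>n. closed (C n)" "\<And>n. convex (C n)" "\<And>n. 0 \<in> C n"
  shows "(\<lambda>n. closest_point (C n) x) \<longlonglongrightarrow> closest_point D x"
proof (rule ccontr)
  define p where "p n = closest_point (C n) x" for n
  assume "\<not> (\<lambda>n. closest_point (C n) x) \<longlonglongrightarrow> closest_point D x"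
  then obtain e where e: "e > 0" "\<And>N. \<exists>n\<ge>N. dist (p n) (closest_point D x) \<ge> e"
    unfolding lim_sequentially p_def by (meson not_less)
  then have "infinite {n. dist (p n) (closest_point D x) \<ge> e}"
    by (auto simp: infinite_nat_iff_unbounded_le)
  then obtain r :: "nat \<Rightarrow> nat"
    where r: "strict_mono r" "\<And>n. dist (p (r n)) (closest_point D x) \<ge> e"
    using infinite_enumerate by blast
  \<comment> \<open>Since \<open>0 \<in> C n\<close>, all projections lie in the ball of radius
    \<open>norm x\<close>, so a further subsequence \<open>s\<close> converges.\<close>
  have "bounded (range (p \<circ> r))"
    unfolding bounded_iff p_def o_def using norm_closest_point_le[OF C] by blast
  then obtain q s where s: "strict_mono (s :: nat \<Rightarrow> nat)" and q: "(p \<circ> r \<circ> s) \<longlonglongrightarrow> q"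
    using bounded_imp_convergent_subsequence by blast
  have rs: "strict_mono (r \<circ> s)"
    using r(1) s by (rule strict_mono_o)
  have pC: "p n \<in> C n" for n
    unfolding p_def using C closest_point_in_set by blast
  have "q \<in> weak_Ls C"
    unfolding weak_Ls_def mem_Collect_eq
  proof (intro exI conjI allI)
    show "strict_mono (r \<circ> s)" by (rule rs)
    show "weakly_converges_to (p \<circ> r \<circ> s) q"
      using q by (rule tendsto_imp_weakly_converges_to)
    show "(p \<circ> r \<circ> s) i \<in> C ((r \<circ> s) i)" for i
      by (simp add: pC)
  qed
  then have qD: "q \<in> D"
    using mosco by (auto simp: mosco_converges_def)
  \<comment> \<open>Approximate the competitor \<open>z\<close> by \<open>y n\<close> in
    \<open>C n\<close>: \<open>p n\<close> is at least as close to \<open>x\<close> as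
    \<open>y n\<close>, and this inequality survives the limit along
    \<open>r \<circ> s\<close>.\<close>
  have "dist x q \<le> dist x z" if "z \<in> D" for z
  proof -
    have "z \<in> strong_Li C"
      using mosco that by (auto simp: mosco_converges_def)
    then obtain y where y: "\<And>n. y n \<in> C n" "y \<longlonglongrightarrow> z"
      unfolding strong_Li_def by blast
    have "(\<lambda>n. dist x (y (r (s n)))) \<longlonglongrightarrow> dist x z"
      using tendsto_dist[OF tendsto_const LIMSEQ_subseq_LIMSEQ[OF y(2) rs]] by (simp add: o_def)
    moreover have "(\<lambda>n. dist x (p (r (s n)))) \<longlonglongrightarrow> dist x q"
      using tendsto_dist[OF tendsto_const q] by (simp add: o_def)
    moreover have "dist x (p n) \<le> dist x (y n)" for n
      unfolding p_def by (rule closest_point_le[OF C(1) y(1)])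
    ultimately show ?thesis
      by (meson LIMSEQ_le)
  qed
  then have "q = closest_point D x"
    using closest_point_unique[OF D(2,1) qD] by blast
  \<comment> \<open>This contradicts the choice of \<open>r\<close>, along which these distances
    stay at least \<open>e\<close>.\<close>
  then have "(\<lambda>n. dist (p (r (s n))) (closest_point D x)) \<longlonglongrightarrow> 0"
    using tendsto_dist[OF q tendsto_const[of q]] by (simp add: o_def)
  then have "e \<le> 0"
    using r(2) LIMSEQ_le_const by blast
  with e(1) show False by simp
qed

section \<open>Processes, their classes and the product measure\<close>

lemma H_space_cases:
  assumes "X \<in> H_space P F T"
  obtains f where "f \<in> L2_ad P F T" "X = H_class P F T f"
  using assms by (auto simp: H_space_def H_class_def elim!: quotientE)

context complete_filtered_prob_space
begin

lemma pair_sigma_finite_time: "pair_sigma_finite (time_measure T) P"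
proof -
  interpret t: sigma_finite_measure "time_measure T"
    by (rule sigma_finite_measure_restrict_space) (auto intro: lborel.sigma_finite_measure_axioms)
  show ?thesis ..
qed

lemma L2_ad_measurable:
  "f \<in> L2_ad P F T \<Longrightarrow> (\<lambda>z. f (fst z) (snd z)) \<in> borel_measurable (time_measure T \<Otimes>\<^sub>M P)"
  by (simp add: L2_ad_def case_prod_beta')

text \<open>Tonelli turns the iterated integral in \<open>L2_ad\<close> into an integral over the
  product measure, where monotonicity and dominated convergence apply in one stroke.\<close>

lemma L2_ad_integrable:
  fixes f :: "real \<Rightarrow> 'w \<Rightarrow> real^'q"
  assumes "f \<in> L2_ad P F T"
  shows "integrable (time_measure T \<Otimes>\<^sub>M P) (\<lambda>z. (norm (f (fst z) (snd z)))\<^sup>2)"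
proof -
  note [measurable] = L2_ad_measurable[OF assms]
  have "(\<integral>\<^sup>+ z. ennreal ((norm (f (fst z) (snd z)))\<^sup>2) \<partial>(time_measure T \<Otimes>\<^sub>M P))
    = (\<integral>\<^sup>+ t. (\<integral>\<^sup>+ w. ennreal ((norm (f t w))\<^sup>2) \<partial>P) \<partial>time_measure T)"
    by (subst nn_integral_fst[symmetric]) (simp_all, measurable)
  also have "\<dots> < \<infinity>"
    using assms by (simp add: L2_ad_def)
  finally show ?thesis
    by (intro integrableI_nonneg) auto
qed

text \<open>Links the iterated quantifiers of \<open>process_eq\<close> and \<open>U_set\<close> to
  almost everywhere statements about product integrals.\<close>

lemma AE_time_prob_iff:
  assumes "Measurable.pred (time_measure T \<Otimes>\<^sub>M P) (\<lambda>z. Q (fst z) (snd z))"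
  shows "(AE t in time_measure T. AE w in P. Q t w)
    \<longleftrightarrow> (AE z in time_measure T \<Otimes>\<^sub>M P. Q (fst z) (snd z))"
  using assms unfolding pred_def by (rule pair_sigma_finite.AE_pair_iff[OF pair_sigma_finite_time])

lemma L2_ad_comp:
  fixes f :: "real \<Rightarrow> 'w \<Rightarrow> real^'q" and g :: "real^'q \<Rightarrow> real^'q"
  assumes f: "f \<in> L2_ad P F T" and g: "continuous_on UNIV g" "\<And>x. norm (g x) \<le> norm x"
  shows "(\<lambda>t w. g (f t w)) \<in> L2_ad P F T"
proof -
  have [measurable]: "g \<in> borel_measurable borel"
    using g(1) by (rule borel_measurable_continuous_onI)
  have "(\<integral>\<^sup>+ t. (\<integral>\<^sup>+ w. ennreal ((norm (g (f t w)))\<^sup>2) \<partial>P) \<partial>time_measure T)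
    \<le> (\<integral>\<^sup>+ t. (\<integral>\<^sup>+ w. ennreal ((norm (f t w))\<^sup>2) \<partial>P) \<partial>time_measure T)"
    by (intro nn_integral_mono ennreal_leI power_mono g) auto
  also have "\<dots> < \<infinity>"
    using f by (simp add: L2_ad_def)
  finally have fin: "(\<integral>\<^sup>+ t. (\<integral>\<^sup>+ w. ennreal ((norm (g (f t w)))\<^sup>2) \<partial>P) \<partial>time_measure T) < \<infinity>" .
  have "(\<lambda>w. g (f t w)) \<in> borel_measurable (F t)" if "t \<in> {0..T}" for t
  proof -
    have [measurable]: "f t \<in> borel_measurable (F t)"
      using f that by (simp add: L2_ad_def)
    show ?thesis by measurable
  qed
  moreover have "(\<lambda>(t, w). g (f t w)) \<in> borel_measurable (time_measure T \<Otimes>\<^sub>M P)"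
    using L2_ad_measurable[OF f] unfolding case_prod_beta' by measurable
  ultimately show ?thesis
    using fin by (simp add: L2_ad_def)
qed

lemma L2_ad_closest_point:
  fixes C :: "(real^'q) set"
  assumes "f \<in> L2_ad P F T" "closed C" "convex C" "0 \<in> C"
  shows "(\<lambda>t w. closest_point C (f t w)) \<in> L2_ad P F T"
  by (rule L2_ad_comp[OF assms(1) continuous_on_closest_point norm_closest_point_le]) (use assms in auto)

lemma H_dist_class:
  fixes f g :: "real \<Rightarrow> 'w \<Rightarrow> real^'q"
  assumes f: "f \<in> L2_ad P F T" and g: "g \<in> L2_ad P F T"
  shows "H_dist P F T (H_class P F T f) (H_class P F T g)
    = sqrt (\<integral>z. (norm (f (fst z) (snd z) - g (fst z) (snd z)))\<^sup>2 \<partial>(time_measure T \<Otimes>\<^sub>M P))"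
proof -
  note d = L2_ad_diff[OF f g]
  have "integrable (time_measure T \<Otimes>\<^sub>M P)
      (\<lambda>(t, w). inner (f t w - g t w) (f t w - g t w))"
    using L2_ad_integrable[OF d] by (simp add: power2_norm_eq_inner case_prod_beta')
  \<comment> \<open>Fubini, after both classes have been replaced by their given
    representatives.\<close>
  from pair_sigma_finite.integral_fst'[OF pair_sigma_finite_time this]
  show ?thesis
    by (simp add: H_dist_def H_norm_def H_minus_class[OF f g] H_inner_class[OF d d]
        power2_norm_eq_inner case_prod_beta')
qed

text \<open>A nonnegative integrand with zero integral vanishes almost everywhere. This definiteness
  of the distance gives uniqueness of the projection.\<close>

lemma H_class_eq_if_H_dist_le_0:
  fixes f g :: "real \<Rightarrow> 'w \<Rightarrow> real^'q"
  assumes f: "f \<in> L2_ad P F T" and g: "g \<in> L2_ad P F T"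
    and le: "H_dist P F T (H_class P F T f) (H_class P F T g) \<le> 0"
  shows "H_class P F T f = H_class P F T g"
proof -
  note [measurable] = L2_ad_measurable[OF f] L2_ad_measurable[OF g]
  let ?h = "\<lambda>z. (norm (f (fst z) (snd z) - g (fst z) (snd z)))\<^sup>2"
  have "integral\<^sup>L (time_measure T \<Otimes>\<^sub>M P) ?h = 0"
    using le by (simp add: H_dist_class[OF f g] order_antisym)
  then have "AE z in time_measure T \<Otimes>\<^sub>M P. ?h z = 0"
    by (subst (asm) integral_nonneg_eq_0_iff_AE) (auto intro: L2_ad_integrable[OF L2_ad_diff[OF f g]])
  then have "AE z in time_measure T \<Otimes>\<^sub>M P. f (fst z) (snd z) = g (fst z) (snd z)"
    by simp
  then have "AE t in time_measure T. AE w in P. f t w = g t w"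
    by (subst AE_time_prob_iff) auto
  then have "(f, g) \<in> process_eq P F T"
    using f g by (simp add: process_eq_def)
  then show ?thesis
    unfolding H_class_def by (rule equiv_class_eq[OF equiv_process_eq])
qed

section \<open>The projection onto \<open>U_set\<close>\<close>

lemma H_dist_pythagoras:
  fixes f g :: "real \<Rightarrow> 'w \<Rightarrow> real^'q"
  assumes f: "f \<in> L2_ad P F T" and g: "g \<in> L2_ad P F T"
    and C: "closed C" "convex C" "0 \<in> C"
    and gC: "H_class P F T g \<in> U_set P F T C"
  defines "p \<equiv> \<lambda>t w. closest_point C (f t w)"
  shows "(H_dist P F T (H_class P F T f) (H_class P F T p))\<^sup>2
      + (H_dist P F T (H_class P F T g) (H_class P F T p))\<^sup>2
    \<le> (H_dist P F T (H_class P F T f) (H_class P F T g))\<^sup>2"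
proof -
  have p: "p \<in> L2_ad P F T"
    unfolding p_def using f C by (rule L2_ad_closest_point)
  note [measurable] = L2_ad_measurable[OF g]
  have [measurable]: "C \<in> sets borel"
    using C(1) by (rule borel_closed)
  \<comment> \<open>Membership in \<open>U_set\<close> constrains \<open>g\<close> only almost
    everywhere, so the pointwise inequality is integrated in its almost everywhere form.\<close>
  have "AE z in time_measure T \<Otimes>\<^sub>M P. g (fst z) (snd z) \<in> C"
    using gC unfolding U_set_class[OF g] by (subst (asm) AE_time_prob_iff) auto
  then have *: "AE z in time_measure T \<Otimes>\<^sub>M P.
      (norm (f (fst z) (snd z) - p (fst z) (snd z)))\<^sup>2 + (norm (g (fst z) (snd z) - p (fst z) (snd z)))\<^sup>2
      \<le> (norm (f (fst z) (snd z) - g (fst z) (snd z)))\<^sup>2"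
    by eventually_elim (simp add: p_def closest_point_pythagoras C)
  note int = L2_ad_integrable[OF L2_ad_diff[OF f p]] L2_ad_integrable[OF L2_ad_diff[OF g p]]
    L2_ad_integrable[OF L2_ad_diff[OF f g]]
  from integral_mono_AE[OF Bochner_Integration.integrable_add[OF int(1,2)] int(3) *]
  show ?thesis
    using int by (simp add: H_dist_class f g p)
qed

text \<open>As \<open>metric_projection\<close> is a definite description, existence and uniqueness
  of the minimiser are both needed; \<open>H_dist_pythagoras\<close> supplies both.\<close>

lemma H_proj_U_set:
  fixes f :: "real \<Rightarrow> 'w \<Rightarrow> real^'q"
  assumes f: "f \<in> L2_ad P F T" and C: "closed C" "convex C" "0 \<in> C"
  shows "H_proj P F T (U_set P F T C) (H_class P F T f)
    = H_class P F T (\<lambda>t w. closest_point C (f t w))"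
proof -
  define p where "p = (\<lambda>t w. closest_point C (f t w))"
  have p: "p \<in> L2_ad P F T"
    unfolding p_def using f C by (rule L2_ad_closest_point)
  have "closest_point C x \<in> C" for x
    using C closest_point_in_set by blast
  then have pU: "H_class P F T p \<in> U_set P F T C"
    by (simp add: U_set_class[OF p]) (simp add: p_def)
  have nonneg: "0 \<le> H_dist P F T (H_class P F T f) (H_class P F T g)"
    if "f \<in> L2_ad P F T" "g \<in> L2_ad P F T" for f g :: "real \<Rightarrow> 'w \<Rightarrow> real^'q"
    using that by (simp add: H_dist_class)
  have "H_proj P F T (U_set P F T C) (H_class P F T f) = H_class P F T p"
    unfolding metric_projection_def
  proof (rule the_equality, intro conjI ballI)
    fix Y assume Y: "Y \<in> U_set P F T C"
    then obtain g where g: "g \<in> L2_ad P F T" "Y = H_class P F T g"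
      by (auto simp: U_set_def elim: H_space_cases)
    \<comment> \<open>Minimality: drop the second square.\<close>
    have "(H_dist P F T (H_class P F T f) (H_class P F T p))\<^sup>2
      \<le> (H_dist P F T (H_class P F T f) Y)\<^sup>2"
      using H_dist_pythagoras[OF f g(1) C Y[unfolded g(2)]] unfolding g(2) p_def
      by (smt (verit) zero_le_power2)
    then show "H_dist P F T (H_class P F T f) (H_class P F T p) \<le> H_dist P F T (H_class P F T f) Y"
      unfolding g(2) using nonneg[OF f g(1)] by (rule power2_le_imp_le)
  next
    fix Y assume Y: "Y \<in> U_set P F T C \<and>
      (\<forall>Z\<in>U_set P F T C. H_dist P F T (H_class P F T f) Y \<le> H_dist P F T (H_class P F T f) Z)"
    then obtain g where g: "g \<in> L2_ad P F T" "Y = H_class P F T g"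
      by (auto simp: U_set_def elim: H_space_cases)
    \<comment> \<open>Uniqueness: a minimiser \<open>Y\<close> is no farther than \<open>p\<close>,
      which leaves no room for the second square.\<close>
    have "(H_dist P F T (H_class P F T f) Y)\<^sup>2 \<le> (H_dist P F T (H_class P F T f) (H_class P F T p))\<^sup>2"
      using Y pU nonneg[OF f g(1)] unfolding g(2) by (intro power_mono) auto
    moreover have "H_class P F T g \<in> U_set P F T C"
      using Y g(2) by simp
    ultimately have "(H_dist P F T Y (H_class P F T p))\<^sup>2 \<le> 0"
      using H_dist_pythagoras[OF f g(1) C] unfolding g(2) p_def by linarith
    then have "H_dist P F T Y (H_class P F T p) \<le> 0"
      by simp
    then show "Y = H_class P F T p"
      unfolding g(2) by (rule H_class_eq_if_H_dist_le_0[OF g(1) p])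
  qed (rule pU)
  then show ?thesis
    unfolding p_def .
qed

section \<open>Dominated convergence in H[0,T]\<close>

lemma H_dist_tendsto_0:
  fixes f g :: "real \<Rightarrow> 'w \<Rightarrow> real^'q" and p :: "nat \<Rightarrow> real \<Rightarrow> 'w \<Rightarrow> real^'q"
  assumes f: "f \<in> L2_ad P F T" and g: "g \<in> L2_ad P F T" and p: "\<And>n. p n \<in> L2_ad P F T"
    and lim: "\<And>t w. (\<lambda>n. p n t w) \<longlonglongrightarrow> g t w"
    and dom: "\<And>n t w. norm (p n t w) \<le> norm (f t w)"
  shows "(\<lambda>n. H_dist P F T (H_class P F T (p n)) (H_class P F T g)) \<longlonglongrightarrow> 0"
proof -
  note [measurable] = L2_ad_measurable[OF g] L2_ad_measurable[OF p]
  \<comment> \<open>The pointwise limit inherits the domination, so the triangle inequality bounds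
    the difference by \<open>2 * norm (f t w)\<close>; squaring gives the integrable majorant with
    factor 4.\<close>
  have gdom: "norm (g t w) \<le> norm (f t w)" for t w
    using LIMSEQ_le_const2[OF tendsto_norm[OF lim]] dom by blast
  have "(norm (p n t w - g t w))\<^sup>2 \<le> (2 * norm (f t w))\<^sup>2" for n t w
    using norm_triangle_ineq4[of "p n t w" "g t w"] dom[of n t w] gdom[of t w]
    by (intro power_mono) auto
  then have bound: "norm ((norm (p n t w - g t w))\<^sup>2) \<le> 4 * (norm (f t w))\<^sup>2" for n t w
    by (simp add: power_mult_distrib)
  have "(\<lambda>n. \<integral>z. (norm (p n (fst z) (snd z) - g (fst z) (snd z)))\<^sup>2 \<partial>(time_measure T \<Otimes>\<^sub>M P))
    \<longlonglongrightarrow> (\<integral>z. 0 \<partial>(time_measure T \<Otimes>\<^sub>M P))"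
  proof (rule integral_dominated_convergence)
    show "integrable (time_measure T \<Otimes>\<^sub>M P) (\<lambda>z. 4 * (norm (f (fst z) (snd z)))\<^sup>2)"
      using L2_ad_integrable[OF f] by simp
    have "(\<lambda>n. (norm (p n t w - g t w))\<^sup>2) \<longlonglongrightarrow> (norm (g t w - g t w))\<^sup>2" for t w
      by (intro tendsto_intros lim)
    then show "AE z in time_measure T \<Otimes>\<^sub>M P.
        (\<lambda>n. (norm (p n (fst z) (snd z) - g (fst z) (snd z)))\<^sup>2) \<longlonglongrightarrow> 0"
      by simp
  qed (use bound in auto)
  from tendsto_real_sqrt[OF this] show ?thesis
    by (simp add: H_dist_class p g)
qed

end

theorem theorem3p1:
  fixes P :: "'w measure" and F :: "real \<Rightarrow> 'w measure" and T :: real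
    and \<mu> :: "'m::complete_space" and \<mu>s :: "nat \<Rightarrow> 'm"
    and K :: "'m \<Rightarrow> (real^'q) set"
    and u :: "(real \<Rightarrow> 'w \<Rightarrow> real^'q) set"
  assumes "complete_filtered_prob_space P F"
    and "T > 0"
    and "(\<lambda>n. dist (\<mu>s n) \<mu>) \<longlonglongrightarrow> 0"
    and "closed (K \<mu>)" "convex (K \<mu>)" "0 \<in> K \<mu>"
    and "\<And>n. closed (K (\<mu>s n))" "\<And>n. convex (K (\<mu>s n))" "\<And>n. 0 \<in> K (\<mu>s n)"
    and "mosco_converges (\<lambda>n. K (\<mu>s n)) (K \<mu>)"
    and "u \<in> H_space P F T"
  shows "(\<lambda>n. H_dist P F T
            (H_proj P F T (U_set P F T (K (\<mu>s n))) u)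
            (H_proj P F T (U_set P F T (K \<mu>)) u)) \<longlonglongrightarrow> 0"
proof -
  interpret complete_filtered_prob_space P F by fact
  obtain f where f: "f \<in> L2_ad P F T" "u = H_class P F T f"
    using \<open>u \<in> H_space P F T\<close> by (rule H_space_cases)
  note K = assms(4-6) and Kn = assms(7-9)
  \<comment> \<open>With both projections written as pointwise closest points, only their
    convergence at each fixed \<open>t\<close> and \<open>w\<close> remains, which is the
    finite-dimensional result.\<close>
  show ?thesis
    unfolding f(2) H_proj_U_set[OF f(1) K] H_proj_U_set[OF f(1) Kn]
  proof (rule H_dist_tendsto_0[OF f(1)])
    show "(\<lambda>n. closest_point (K (\<mu>s n)) (f t w)) \<longlonglongrightarrow> closest_point (K \<mu>) (f t w)" for t w
      using assms(10) K(1,2) Kn by (rule mosco_converges_imp_closest_point_tendsto)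
  qed (use f(1) K Kn in \<open>auto intro: L2_ad_closest_point norm_closest_point_le\<close>)
qed

end
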